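(* Let $m\ge 2$ be an integer with prime factorization $m=p_{1}^{r_{1}}\cdots p_{k}^{r_{k}}$, let $\{a_n\}_{n\ge 1}$ be the sequence defined in the context, let $T$ be its least period, and for each $1\le i\le k$ let $T_i$ be the least period of the sequence $\{a_{n} \bmod p_{i}^{r_{i}}\}_{n\ge 1}$. Let $w_i$ be the integer defined by $p_{i}^{w_{i}}=\gcd(\lambda(m)/\lambda(p_{i}^{r_{i}}),\,p_{i}^{r_{i}})$. Then for each $1\le i\le k$: if $p_{i}$ is an odd prime, then $$T_{i}=\begin{cases} 1 & \text{if } w_{i}=r_{i},\\ p_{i}^{r_{i}-w_{i}+1} & \text{if } w_{i}<r_{i};\end{cases}$$ and if $p_{i}=2$, then $$T_{i}=\begin{cases} 1 & \text{if } w_{i}=r_{i},\\ 4 & \text{if } r_{i}=1,\ w_{i}=0,\\ 8 & \text{if } r_{i}=2,\ w_{i}=0,\\ 1 & \text{if } r_{i}=2,\ w_{i}=1,\\ 2^{r_{i}-w_{i}+2} & \text{if } r_{i}\ge 3,\ w_{i}<r_{i}.\end{cases}$$ In particular, the least period of $\{a_n\}$ is $T=T_{1}T_{2}\cdots T_{k}$.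
   Context: $\lambda$ denotes the Carmichael function: $\lambda(m)$ is the exponent of the multiplicative group $(\mathbb{Z}/m\mathbb{Z})^{*}$. For coprime integers $m\ge 2$ and $a$, the Carmichael quotient is $C_{m}(a)=\frac{a^{\lambda(m)}-1}{m}$. Definition of the sequence: let $m=p_{1}^{r_{1}}\cdots p_{k}^{r_{k}}$ be the prime factorization of $m\ge2$ (distinct primes $p_i$, $r_i\ge 1$). For each $i$ put $m_{i}=m/p_{i}^{r_{i}}$ and let $m_i'$ be an integer with $m_{i}^{2}m_{i}'\equiv 1\pmod{p_{i}^{r_{i}}}$. Extend the definition of $C_{p_i^{r_i}}$ by the convention $C_{p_{i}^{r_{i}}}(n)=0$ whenever $p_{i}\mid n$. For every integer $n\ge 1$, $a_n$ is the unique integer with $$a_{n}\equiv \sum_{i=1}^{k}\frac{m_{i}m_{i}'\lambda(m)}{\lambda(p_{i}^{r_{i}})}\,C_{p_{i}^{r_{i}}}(n)\pmod{m},\qquad 0\le a_{n}\le m-1.$$ A positive integer $j$ is a period of a sequence $\{s_n\}_{n\ge1}$ if $s_{n+j}=s_n$ for all $n\ge 1$; the least period is the smallest such $j$. *)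

theory Defs
  imports "HOL-Number_Theory.Number_Theory"
begin

text \<open>
  The Carmichael quotient is only meaningful for \<open>m \<ge> 2\<close> and \<open>a\<close> coprime to \<open>m\<close>;
  the division is then exact.
\<close>

definition carmichael_quotient :: "nat \<Rightarrow> int \<Rightarrow> int" where
  "carmichael_quotient m a = (a ^ Carmichael m - 1) div int m"

text \<open>
  For a prime power modulus \<open>p ^ r\<close>, the quotient is extended by 0 to the multiples of \<open>p\<close>.
\<close>

definition carmichael_quotient_pp :: "nat \<Rightarrow> nat \<Rightarrow> int \<Rightarrow> int" where
  "carmichael_quotient_pp p r n =
     (if int p dvd n then 0 else carmichael_quotient (p ^ r) n)"

text \<open>
  Sequences are indexed from 1: the value at index 0 is irrelevant.
\<close>

definition is_period :: "(nat \<Rightarrow> 'a) \<Rightarrow> nat \<Rightarrow> bool" where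
  "is_period s j \<longleftrightarrow> j > 0 \<and> (\<forall>n\<ge>1. s (n + j) = s n)"

definition is_least_period :: "(nat \<Rightarrow> 'a) \<Rightarrow> nat \<Rightarrow> bool" where
  "is_least_period s t \<longleftrightarrow> is_period s t \<and> (\<forall>j. is_period s j \<longrightarrow> t \<le> j)"

end

theory Submission
  imports Defs
begin

text \<open>
  Modulo \<open>p\<^sub>i ^ r\<^sub>i\<close> only the \<open>i\<close>-th summand of \<open>a\<^sub>n\<close> survives, and its coefficient is a unit times
  \<open>p\<^sub>i ^ w\<^sub>i\<close>, so \<open>T\<^sub>i\<close> is the least period of \<open>C(n) mod p ^ e\<close> with \<open>e = r\<^sub>i - w\<^sub>i\<close>, where \<open>C\<close> is the
  quotient for \<open>p ^ r\<close>. Write \<open>\<lambda>(p ^ r) = p ^ j d\<close> with \<open>d\<close> coprime to \<open>p\<close>. The residue \<open>C(n) mod p ^ e\<close>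
  depends on \<open>n ^ \<lambda>(p ^ r)\<close> modulo \<open>p ^ (r + e)\<close>. Raising to the power \<open>p ^ j\<close> improves a congruence
  modulo \<open>p ^ s\<close> to one modulo \<open>p ^ (s + j)\<close> and no further, if \<open>p\<close> is odd or \<open>s \<ge> 2\<close> or \<open>j = 0\<close>;
  hence the least period is \<open>p ^ (r + e - j)\<close> for \<open>e \<ge> 1\<close>. The one exception is \<open>p ^ r = 4\<close>, \<open>e = 1\<close>,
  where \<open>C\<close> is always even because odd squares are 1 modulo 8.
  The periods of \<open>a\<close> are the common periods of its reductions, that is, the common multiples
  of the pairwise coprime \<open>T\<^sub>i\<close>.
\<close>

section \<open>Least periods\<close>

text \<open>Periodicity depends only on which terms coincide. A sequence may therefore be exchanged
  for another with the same coincidences, as is done later to strip the coefficient off the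
  Carmichael quotients.\<close>

lemma is_period_cong:
  assumes "\<And>x y. x \<ge> 1 \<Longrightarrow> y \<ge> 1 \<Longrightarrow> s x = s y \<longleftrightarrow> s' x = s' y"
  shows "is_period s j \<longleftrightarrow> is_period s' j"
  using assms by (auto simp: is_period_def)

lemma is_least_period_cong:
  assumes "\<And>x y. x \<ge> 1 \<Longrightarrow> y \<ge> 1 \<Longrightarrow> s x = s y \<longleftrightarrow> s' x = s' y"
  shows "is_least_period s t \<longleftrightarrow> is_least_period s' t"
  using is_period_cong[of s s', OF assms] by (simp add: is_least_period_def)

lemma is_least_period_1:
  assumes "\<And>x y. x \<ge> 1 \<Longrightarrow> y \<ge> 1 \<Longrightarrow> s x = s y"
  shows "is_least_period s 1"
proof -
  have "s (n + 1) = s n" if "n \<ge> 1" for n using that by (intro assms) auto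
  thus ?thesis by (simp add: is_least_period_def is_period_def Suc_le_eq)
qed

lemma is_period_mult:
  assumes "is_period s t" "c > 0"
  shows "is_period s (t * c)"
proof -
  have "\<forall>n\<ge>1. s (n + t * c) = s n"
  proof (induction c)
    case (Suc c)
    show ?case
    proof (intro allI impI)
      fix n :: nat assume "n \<ge> 1"
      hence "s (n + t * c + t) = s (n + t * c)"
        using assms(1) by (simp add: is_period_def)
      thus "s (n + t * Suc c) = s n"
        using Suc \<open>n \<ge> 1\<close> by (simp add: algebra_simps)
    qed
  qed simp
  thus ?thesis using assms by (simp add: is_period_def)
qed

text \<open>Shifts by \<open>j\<close> and by a multiple of \<open>t\<close> both preserve the
  sequence, so a positive remainder \<open>j mod t\<close> would be a period below
  \<open>t\<close>.\<close>

lemma is_least_period_dvd: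
  assumes t: "is_least_period s t" and j: "is_period s j"
  shows "t dvd j"
proof (rule ccontr)
  assume "\<not> t dvd j"
  hence pos: "j mod t > 0" by (simp add: mod_greater_zero_iff_not_dvd)
  have per: "is_period s t" using t by (simp add: is_least_period_def)
  hence "t > 0" by (simp add: is_period_def)
  have "s (n + j mod t) = s n" if "n \<ge> 1" for n
  \<comment> \<open>Quotient 0 is treated apart because \<open>is_period\<close> excludes the shift
    0.\<close>
  proof (cases "j div t = 0")
    case True
    hence "j mod t = j" using mult_div_mod_eq[of t j] by simp
    thus ?thesis using j that by (simp add: is_period_def)
  next
    case False
    hence "is_period s (t * (j div t))" by (intro is_period_mult per) simp
    moreover have "n + j mod t \<ge> 1" using that by simp
    ultimately have "s (n + j mod t + t * (j div t)) = s (n + j mod t)"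
      unfolding is_period_def by blast
    moreover have "n + j mod t + t * (j div t) = n + j"
      by (simp only: add.assoc mod_mult_div_eq)
    ultimately have "s (n + j) = s (n + j mod t)" by (simp only:)
    thus ?thesis using j that by (simp add: is_period_def)
  qed
  hence "is_period s (j mod t)" using pos by (simp add: is_period_def)
  hence "t \<le> j mod t" using t by (simp add: is_least_period_def)
  with mod_less_divisor[OF \<open>t > 0\<close>, of j] show False by simp
qed

lemma is_least_period_iff:
  "is_least_period s t \<longleftrightarrow> t > 0 \<and> (\<forall>j. is_period s j \<longleftrightarrow> j > 0 \<and> t dvd j)"
proof
  assume t: "is_least_period s t"
  hence per: "is_period s t" by (simp add: is_least_period_def)
  have "is_period s j" if j: "j > 0" "t dvd j" for j
  proof -
    obtain c where "j = t * c" using j(2) by (rule dvdE)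
    thus ?thesis using is_period_mult[OF per, of c] j(1) by auto
  qed
  thus "t > 0 \<and> (\<forall>j. is_period s j \<longleftrightarrow> j > 0 \<and> t dvd j)"
    using is_least_period_dvd[OF t] per by (auto simp: is_period_def)
next
  assume "t > 0 \<and> (\<forall>j. is_period s j \<longleftrightarrow> j > 0 \<and> t dvd j)"
  thus "is_least_period s t" by (auto simp: is_least_period_def dvd_imp_le)
qed

text \<open>The least period divides \<open>p ^ Suc k\<close>, so it is a power of \<open>p\<close>;
  any smaller power would divide \<open>p ^ k\<close> and make that a period. Two tests thus
  determine the least period.\<close>

lemma is_least_period_prime_power:
  assumes p: "prime p" and per: "is_period s (p ^ Suc k)" and nper: "\<not> is_period s (p ^ k)"
  shows "is_least_period s (p ^ Suc k)"
proof -
  define t where "t = (LEAST j. is_period s j)"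
  have t: "is_least_period s t"
    unfolding is_least_period_def t_def using per by (blast intro: LeastI Least_le)
  have "t dvd p ^ Suc k" using t per by (rule is_least_period_dvd)
  then obtain i where i: "i \<le> Suc k" "t = p ^ i"
    using divides_primepow_nat[OF p] by blast
  have "\<not> t dvd p ^ k"
    using t nper p by (simp add: is_least_period_iff prime_gt_0_nat)
  hence "\<not> i \<le> k" using i by (auto simp: le_imp_power_dvd)
  hence "i = Suc k" using i(1) by simp
  thus ?thesis using t i(2) by simp
qed

section \<open>Combining pairwise coprime periods\<close>

lemma prod_coprime_dvd_iff:
  fixes t :: "'b \<Rightarrow> nat"
  assumes "finite A" "\<And>i j. i \<in> A \<Longrightarrow> j \<in> A \<Longrightarrow> i \<noteq> j \<Longrightarrow> coprime (t i) (t j)"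
  shows "prod t A dvd n \<longleftrightarrow> (\<forall>i\<in>A. t i dvd n)"
  using assms
proof (induction A rule: finite_induct)
  case (insert i A)
  have "coprime (t i) (prod t A)"
    by (rule prod_coprime_right) (use insert in auto)
  hence "t i * prod t A dvd n \<longleftrightarrow> t i dvd n \<and> prod t A dvd n"
    by (auto intro: divides_mult dest: dvd_mult_left dvd_mult_right)
  thus ?case using insert by simp
qed simp

lemma is_least_period_prod:
  fixes t :: "'b \<Rightarrow> nat" and s :: "'b \<Rightarrow> nat \<Rightarrow> 'c" and a :: "nat \<Rightarrow> 'd"
  assumes "finite A" and "A \<noteq> {}"
    and cop: "\<And>i j. i \<in> A \<Longrightarrow> j \<in> A \<Longrightarrow> i \<noteq> j \<Longrightarrow> coprime (t i) (t j)"
    and lp: "\<And>i. i \<in> A \<Longrightarrow> is_least_period (s i) (t i)"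
    and eq: "\<And>x y. x \<ge> 1 \<Longrightarrow> y \<ge> 1 \<Longrightarrow> a x = a y \<longleftrightarrow> (\<forall>i\<in>A. s i x = s i y)"
  shows "is_least_period a (prod t A)"
proof -
  \<comment> \<open>For empty \<open>A\<close> the right-hand side would hold at
    \<open>j = 0\<close> too.\<close>
  have "is_period a j \<longleftrightarrow> (\<forall>i\<in>A. is_period (s i) j)" for j
    using eq \<open>A \<noteq> {}\<close> by (auto simp: is_period_def)
  moreover have "is_period (s i) j \<longleftrightarrow> j > 0 \<and> t i dvd j" if "i \<in> A" for i j
    using lp[OF that] by (simp add: is_least_period_iff)
  ultimately have "is_period a j \<longleftrightarrow> j > 0 \<and> prod t A dvd j" for j
    using \<open>A \<noteq> {}\<close> by (auto simp: prod_coprime_dvd_iff[OF \<open>finite A\<close> cop])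
  moreover have "prod t A > 0"
    using lp by (intro prod_pos) (simp add: is_least_period_iff)
  ultimately show ?thesis by (simp add: is_least_period_iff)
qed

section \<open>Congruences modulo prime powers\<close>

text \<open>In \<open>x ^ p - y ^ p = (x - y) * S\<close> the cofactor \<open>S\<close> has
  \<open>p\<close> terms, each congruent to \<open>y ^ (p - 1)\<close> modulo \<open>p\<close>, and
  so contributes the extra factor \<open>p\<close>.\<close>

lemma cong_power_Suc_modulus:
  fixes x y :: int
  assumes "[x = y] (mod int p ^ s)" "s \<ge> 1"
  shows "[x ^ p = y ^ p] (mod int p ^ Suc s)"
proof -
  have "int p dvd int p ^ s" using assms(2) by (simp add: dvd_power)
  hence xy: "[x = y] (mod int p)" using assms(1) by (rule cong_dvd_modulus[rotated])
  have "[(\<Sum>i<p. y ^ (p - Suc i) * x ^ i) = (\<Sum>i<p. y ^ (p - Suc i) * y ^ i)] (mod int p)"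
    by (intro cong_sum cong_mult cong_refl cong_pow xy)
  also have "(\<Sum>i<p. y ^ (p - Suc i) * y ^ i) = (\<Sum>i<p. y ^ (p - 1))"
    by (intro sum.cong refl) (simp flip: power_add)
  also have "[\<dots> = 0] (mod int p)" by (simp add: cong_0_iff)
  finally have "int p dvd (\<Sum>i<p. y ^ (p - Suc i) * x ^ i)" by (simp add: cong_0_iff)
  moreover have "int p ^ s dvd x - y" using assms(1) by (simp add: cong_iff_dvd_diff)
  ultimately have "int p ^ s * int p dvd (x - y) * (\<Sum>i<p. y ^ (p - Suc i) * x ^ i)"
    by (intro mult_dvd_mono)
  thus ?thesis by (simp add: cong_iff_dvd_diff power_diff_sumr2 mult.commute)
qed

lemma cong_power_prime_power_modulus:
  fixes x y :: int
  assumes "[x = y] (mod int p ^ s)" "s \<ge> 1"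
  shows "[x ^ (p ^ j) = y ^ (p ^ j)] (mod int p ^ (s + j))"
proof (induction j)
  case (Suc j)
  have "[(x ^ (p ^ j)) ^ p = (y ^ (p ^ j)) ^ p] (mod int p ^ Suc (s + j))"
    using Suc assms(2) by (intro cong_power_Suc_modulus) auto
  thus ?case by (simp add: power_mult mult.commute flip: power_mult)
qed (use assms in simp)

section \<open>Binomial expansions and sharpness of the lifting\<close>

lemma one_plus_power_cong_linear:
  fixes z :: int
  shows "[(1 + z) ^ n = 1 + int n * z] (mod z ^ 2)"
proof (induction n)
  case (Suc n)
  have "[(1 + z) ^ n * (1 + z) = (1 + int n * z) * (1 + z)] (mod z ^ 2)"
    using Suc by (intro cong_mult cong_refl)
  also have "(1 + int n * z) * (1 + z) = 1 + int (Suc n) * z + z ^ 2 * int n"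
    by (simp add: algebra_simps power2_eq_square)
  also have "[\<dots> = 1 + int (Suc n) * z] (mod z ^ 2)"
    by (simp add: cong_iff_dvd_diff)
  finally show ?case by (simp add: mult.commute)
qed simp

lemma one_plus_power_cong_quadratic:
  fixes z :: int
  shows "[(1 + z) ^ n = 1 + int n * z + int (n choose 2) * z ^ 2] (mod z ^ 3)"
proof (induction n)
  case (Suc n)
  let ?c = "int (n choose 2)"
  have "[(1 + z) ^ n * (1 + z) = (1 + int n * z + ?c * z ^ 2) * (1 + z)] (mod z ^ 3)"
    using Suc by (intro cong_mult cong_refl)
  also have "(1 + int n * z + ?c * z ^ 2) * (1 + z)
             = 1 + int (Suc n) * z + int (Suc n choose 2) * z ^ 2 + z ^ 3 * ?c"
    by (simp add: algebra_simps power2_eq_square power3_eq_cube numeral_2_eq_2)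
  also have "[\<dots> = 1 + int (Suc n) * z + int (Suc n choose 2) * z ^ 2] (mod z ^ 3)"
    by (simp add: cong_iff_dvd_diff)
  finally show ?case by (simp add: mult.commute)
qed (simp add: numeral_2_eq_2)

text \<open>For \<open>s \<ge> 2\<close> the terms beyond the linear one vanish because
  \<open>2 * s \<ge> s + 2\<close>. For \<open>s = 1\<close> the quadratic term survives unless
  \<open>p\<close> divides \<open>p choose 2\<close>, which needs \<open>p\<close> odd:
  \<open>3 ^ 2 = 9\<close> is not 5 modulo 8.\<close>

lemma one_plus_prime_power_step:
  assumes "prime p" "s \<ge> 1" "odd p \<or> s \<ge> 2"
  shows "[(1 + int p ^ s) ^ p = 1 + int p ^ Suc s] (mod int p ^ (s + 2))"
proof (cases "s \<ge> 2")
  case True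
  have "[(1 + int p ^ s) ^ p = 1 + int p * int p ^ s] (mod (int p ^ s) ^ 2)"
    by (rule one_plus_power_cong_linear)
  moreover have "int p ^ (s + 2) dvd (int p ^ s) ^ 2"
    unfolding power_mult [symmetric] using True by (intro le_imp_power_dvd) simp
  ultimately show ?thesis by (auto dest: cong_dvd_modulus)
next
  case False
  hence s: "s = 1" and "odd p" using assms by auto
  have "p dvd p choose 2"
    using assms(1) \<open>odd p\<close> prime_ge_2_nat[OF assms(1)]
    by (intro dvd_choose_prime) (auto simp: le_less)
  hence dvd: "int p ^ 3 dvd int (p choose 2) * int p ^ 2"
    by (auto simp: power3_eq_cube power2_eq_square)
  have "[(1 + int p) ^ p = 1 + int p * int p + int (p choose 2) * int p ^ 2] (mod int p ^ 3)"
    by (rule one_plus_power_cong_quadratic)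
  also have "[1 + int p * int p + int (p choose 2) * int p ^ 2 = 1 + int p * int p] (mod int p ^ 3)"
    using dvd by (simp add: cong_iff_dvd_diff)
  finally show ?thesis by (simp add: s numeral_3_eq_3)
qed

text \<open>The modulus is one power of \<open>p\<close> finer than the deviation
  \<open>p ^ (s + j)\<close>, so the deviation stays visible. With \<open>j = 0\<close> no step is
  taken, which admits \<open>p = 2\<close> and \<open>s = 1\<close>.\<close>

lemma one_plus_prime_power_pow:
  assumes "prime p" "s \<ge> 1" "odd p \<or> s \<ge> 2 \<or> j = 0"
  shows "[(1 + int p ^ s) ^ (p ^ j) = 1 + int p ^ (s + j)] (mod int p ^ Suc (s + j))"
  using assms(3)
proof (induction j)
  case (Suc j)
  have "[(1 + int p ^ s) ^ (p ^ j) = 1 + int p ^ (s + j)] (mod int p ^ Suc (s + j))"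
    using Suc by auto
  hence "[((1 + int p ^ s) ^ (p ^ j)) ^ p = (1 + int p ^ (s + j)) ^ p] (mod int p ^ Suc (Suc (s + j)))"
    by (intro cong_power_Suc_modulus) auto
  also have "[(1 + int p ^ (s + j)) ^ p = 1 + int p ^ Suc (s + j)] (mod int p ^ Suc (Suc (s + j)))"
    using one_plus_prime_power_step[of p "s + j"] assms(1,2) Suc.prems by auto
  finally show ?case by (simp add: mult.commute flip: power_mult)
qed simp

text \<open>The \<open>d\<close>-th power multiplies the deviation \<open>p ^ (s + j)\<close> by
  \<open>d\<close>, which is prime to \<open>p\<close>, so it cannot disappear.\<close>

lemma one_plus_prime_power_pow_not_cong_1:
  assumes "prime p" "s \<ge> 1" "odd p \<or> s \<ge> 2 \<or> j = 0" "coprime d p"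
  shows "\<not> [(1 + int p ^ s) ^ (p ^ j * d) = 1] (mod int p ^ Suc (s + j))"
proof
  let ?q = "int p ^ (s + j)" and ?N = "int p ^ Suc (s + j)"
  assume *: "[(1 + int p ^ s) ^ (p ^ j * d) = 1] (mod ?N)"
  have "[(1 + int p ^ s) ^ (p ^ j * d) = (1 + ?q) ^ d] (mod ?N)"
    unfolding power_mult using one_plus_prime_power_pow[OF assms(1-3)] by (rule cong_pow)
  also have "?N dvd ?q ^ 2"
    unfolding power_mult [symmetric] using assms(2) by (intro le_imp_power_dvd) simp
  hence "[(1 + ?q) ^ d = 1 + int d * ?q] (mod ?N)"
    using one_plus_power_cong_linear[of ?q d] by (rule cong_dvd_modulus[rotated])
  finally have "[1 = 1 + int d * ?q] (mod ?N)" using * by (metis cong_sym cong_trans)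
  hence "?N dvd int d * ?q" by (simp add: cong_iff_dvd_diff)
  hence "int p dvd int d" using prime_gt_0_nat[OF assms(1)] by simp
  hence "p dvd d" by simp
  with assms(1,4) show False by (metis coprime_common_divisor dvd_refl not_prime_unit)
qed

text \<open>This converts the factor \<open>p i ^ w i\<close> of a coefficient into a loss of
  \<open>w i\<close> in the exponent of the modulus.\<close>

lemma cong_mult_cancel_gcd:
  fixes q x y N :: int
  assumes "N > 0"
  shows "[q * x = q * y] (mod N) \<longleftrightarrow> [x = y] (mod N div gcd q N)"
proof -
  define g where "g = gcd q N"
  have g: "g > 0" using assms by (simp add: g_def)
  define q' N' where "q' = q div g" and "N' = N div g"
  have q: "q = g * q'" and N: "N = g * N'"
    by (simp_all add: g_def q'_def N'_def)
  have cop: "coprime q' N'"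
    unfolding q'_def N'_def g_def using assms by (intro div_gcd_coprime) auto
  have "[q * x = q * y] (mod N) \<longleftrightarrow> N dvd q * (x - y)"
    by (simp add: cong_iff_dvd_diff algebra_simps)
  also have "\<dots> \<longleftrightarrow> N' dvd q' * (x - y)"
    unfolding q N using g by (simp add: mult.assoc)
  also have "\<dots> \<longleftrightarrow> N' dvd x - y"
    using cop by (simp add: coprime_commute coprime_dvd_mult_right_iff)
  finally show ?thesis by (simp add: cong_iff_dvd_diff N'_def g_def)
qed

section \<open>Carmichael quotients of prime powers\<close>

lemma carmichael_quotient_mult:
  assumes "coprime x (int m)" "m > 0"
  shows "int m * carmichael_quotient m x = x ^ Carmichael m - 1"
proof (cases "m = 1")
  case False
  \<comment> \<open>\<open>power_Carmichael_eq_1\<close> is about natural numbers, so the integer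
    \<open>x\<close> is replaced by its nonnegative residue.\<close>
  define y where "y = nat (x mod int m)"
  have y: "int y = x mod int m" using assms(2) by (simp add: y_def)
  have "coprime (int y) (int m)" unfolding y using assms by (simp add: coprime_mod_left_iff)
  hence "[y ^ Carmichael m = 1] (mod m)"
    using assms(2) False by (intro power_Carmichael_eq_1) (auto simp: coprime_commute)
  hence "[int y ^ Carmichael m = 1] (mod int m)"
    by (metis cong_int_iff of_nat_1 of_nat_power)
  moreover have "[int y ^ Carmichael m = x ^ Carmichael m] (mod int m)"
    unfolding y by (intro cong_pow) simp
  ultimately have "[x ^ Carmichael m = 1] (mod int m)" by (metis cong_sym cong_trans)
  thus ?thesis by (simp add: carmichael_quotient_def cong_iff_dvd_diff)
qed (simp add: carmichael_quotient_def)

lemma carmichael_quotient_cong_iff: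
  assumes p: "prime p" and x: "\<not> int p dvd x" and y: "\<not> int p dvd y"
  shows "[carmichael_quotient (p ^ r) x = carmichael_quotient (p ^ r) y] (mod int p ^ e) \<longleftrightarrow>
         [x ^ Carmichael (p ^ r) = y ^ Carmichael (p ^ r)] (mod int p ^ (r + e))"
proof -
  have *: "int p ^ r * carmichael_quotient (p ^ r) z = z ^ Carmichael (p ^ r) - 1"
    if "\<not> int p dvd z" for z
  proof -
    have "coprime z (int p)"
      using prime_imp_coprime[of "int p" z] p that by (simp add: coprime_commute)
    hence "coprime z (int (p ^ r))" by simp
    from carmichael_quotient_mult[OF this] p show ?thesis by (simp add: prime_gt_0_nat)
  qed
  have "x ^ Carmichael (p ^ r) - y ^ Carmichael (p ^ r) =
        int p ^ r * (carmichael_quotient (p ^ r) x - carmichael_quotient (p ^ r) y)"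
    using *[OF x] *[OF y] by (simp add: algebra_simps)
  moreover have "p \<noteq> 0" using p by auto
  ultimately show ?thesis by (simp add: cong_iff_dvd_diff power_add)
qed

text \<open>The number \<open>s\<close> is fixed by \<open>r + e = Suc (s + j)\<close>: it is the
  last exponent at which a congruence of the arguments is too coarse to reach modulus
  \<open>p ^ (r + e)\<close>.\<close>

lemma is_least_period_carmichael_quotient_pp:
  assumes p: "prime p" and lam: "Carmichael (p ^ r) = p ^ j * d" and d: "coprime d p"
    and s: "s \<ge> 1" and sj: "odd p \<or> s \<ge> 2 \<or> j = 0" and e: "r + e = Suc (s + j)"
  shows "is_least_period (\<lambda>n. carmichael_quotient_pp p r (int n) mod int p ^ e) (p ^ Suc s)"
proof (rule is_least_period_prime_power[OF p])
  show "is_period (\<lambda>n. carmichael_quotient_pp p r (int n) mod int p ^ e) (p ^ Suc s)"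
    unfolding is_period_def
  proof (intro conjI allI impI)
    fix n :: nat assume "n \<ge> 1"
    let ?x = "int (n + p ^ Suc s)"
    \<comment> \<open>The shift respects the extension by 0, so only arguments prime to
      \<open>p\<close> remain to be compared.\<close>
    have dvd: "int p dvd ?x \<longleftrightarrow> int p dvd int n" by (simp add: dvd_add_left_iff)
    show "carmichael_quotient_pp p r ?x mod int p ^ e =
          carmichael_quotient_pp p r (int n) mod int p ^ e"
    proof (cases "int p dvd int n")
      case False
      have "[?x = int n] (mod int p ^ Suc s)" by (simp add: cong_iff_dvd_diff)
      hence "[?x ^ (p ^ j) = int n ^ (p ^ j)] (mod int p ^ (Suc s + j))"
        by (rule cong_power_prime_power_modulus) simp
      hence "[?x ^ (p ^ j * d) = int n ^ (p ^ j * d)] (mod int p ^ (r + e))"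
        unfolding power_mult e add_Suc by (rule cong_pow)
      hence "[carmichael_quotient (p ^ r) ?x = carmichael_quotient (p ^ r) (int n)] (mod int p ^ e)"
        using carmichael_quotient_cong_iff[OF p, of ?x "int n" r e] False dvd lam by metis
      thus ?thesis using False dvd by (simp add: carmichael_quotient_pp_def cong_def)
    qed (use dvd in \<open>simp add: carmichael_quotient_pp_def\<close>)
  qed (use p in \<open>simp add: prime_gt_0_nat\<close>)
next
  show "\<not> is_period (\<lambda>n. carmichael_quotient_pp p r (int n) mod int p ^ e) (p ^ s)"
  proof
    assume "is_period (\<lambda>n. carmichael_quotient_pp p r (int n) mod int p ^ e) (p ^ s)"
    \<comment> \<open>The shift \<open>p ^ s\<close> already fails at \<open>n = 1\<close>.\<close>
    hence "carmichael_quotient_pp p r (int (1 + p ^ s)) mod int p ^ e =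
           carmichael_quotient_pp p r (int 1) mod int p ^ e"
      unfolding is_period_def by blast
    moreover have 1: "\<not> int p dvd 1" using p by auto
    moreover have x: "\<not> int p dvd 1 + int p ^ s"
      using 1 s by (simp add: dvd_add_left_iff)
    ultimately have "[carmichael_quotient (p ^ r) (1 + int p ^ s) = carmichael_quotient (p ^ r) 1]
                     (mod int p ^ e)"
      by (simp add: carmichael_quotient_pp_def cong_def)
    hence "[(1 + int p ^ s) ^ (p ^ j * d) = 1] (mod int p ^ Suc (s + j))"
      using carmichael_quotient_cong_iff[OF p x 1, of r e] lam e by simp
    thus False using one_plus_prime_power_pow_not_cong_1[OF p s sj d] by simp
  qed
qed

text \<open>The last branch also yields 4 and 8 for the moduli 2 and 4 with \<open>w = 0\<close>,
  since there the Carmichael function is still \<open>p ^ (r - 1) * (p - 1)\<close>. From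
  \<open>2 ^ 3\<close> on it is \<open>2 ^ (r - 2)\<close>, which costs one more factor 2 in the
  period.\<close>

definition quotient_period_exponent :: "nat \<Rightarrow> nat \<Rightarrow> nat \<Rightarrow> nat" where
  "quotient_period_exponent p r w =
     (if w = r \<or> p = 2 \<and> r = 2 \<and> w = 1 then 0
      else if p = 2 \<and> r \<ge> 3 then r - w + 2 else r - w + 1)"

text \<open>For odd \<open>x = 2 * c + 1\<close> the quotient \<open>(x ^ 2 - 1) / 4\<close> is the
  product of the consecutive integers \<open>c\<close> and \<open>c + 1\<close>.\<close>

lemma carmichael_quotient_pp_2_2_even: "carmichael_quotient_pp 2 2 x mod 2 = 0"
proof (cases "even x")
  case False
  then obtain c where c: "x = 2 * c + 1" by (rule oddE)
  have "x ^ 2 - 1 = 4 * (c * (c + 1))"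
    by (simp add: c power2_eq_square algebra_simps)
  hence "carmichael_quotient_pp 2 2 x = c * (c + 1)"
    using False by (simp add: carmichael_quotient_pp_def carmichael_quotient_def)
  thus ?thesis by simp
qed (simp add: carmichael_quotient_pp_def)

lemma is_least_period_carmichael_quotient_pp_mod:
  assumes p: "prime p" and r: "r \<ge> 1" and w: "w \<le> r"
  shows "is_least_period (\<lambda>n. carmichael_quotient_pp p r (int n) mod int p ^ (r - w))
           (p ^ quotient_period_exponent p r w)"
proof -
  consider "w = r" | "p = 2" "r = 2" "w = 1"
    | "w < r" "odd p" | "p = 2" "r = 1" "w = 0" | "p = 2" "r = 2" "w = 0"
    | "p = 2" "r \<ge> 3" "w < r"
    using r w prime_odd_nat[OF p] prime_ge_2_nat[OF p] by linarith
  thus ?thesis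
  proof cases
    case 1
    thus ?thesis
      unfolding quotient_period_exponent_def by (simp add: is_least_period_1[simplified])
  next
    \<comment> \<open>Here \<open>j = 1\<close> and \<open>s = 1\<close> with \<open>p = 2\<close>,
      exactly the combination excluded by the general lemma.\<close>
    case 2
    thus ?thesis unfolding quotient_period_exponent_def
      by (simp add: is_least_period_1[simplified] carmichael_quotient_pp_2_2_even)
  next
    case 3
    have "coprime (p - 1) p"
      using p by (intro coprime_diff_one_left_nat) (simp add: prime_gt_0_nat)
    moreover have "Carmichael (p ^ r) = p ^ (r - 1) * (p - 1)"
      using Carmichael_odd_prime_power[OF p \<open>odd p\<close>, of r] r by simp
    ultimately show ?thesis
      \<comment> \<open>In this and the following cases the instances after \<open>r\<close> are
        \<open>j\<close>, \<open>d\<close>, \<open>s\<close>, \<open>e\<close>: the first two are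
        read off the Carmichael function, \<open>e\<close> is \<open>r - w\<close>, and
        \<open>s\<close> solves \<open>r + e = Suc (s + j)\<close>.\<close>
      using is_least_period_carmichael_quotient_pp[OF p, of r "r - 1" "p - 1" "r - w" "r - w"] 3
      by (auto simp: quotient_period_exponent_def)
  next
    case 4
    thus ?thesis
      using is_least_period_carmichael_quotient_pp[OF p, of r 0 1 1 1]
      by (simp add: quotient_period_exponent_def)
  next
    case 5
    thus ?thesis
      using is_least_period_carmichael_quotient_pp[OF p, of r 1 1 2 2]
      by (simp add: quotient_period_exponent_def)
  next
    case 6
    thus ?thesis
      using is_least_period_carmichael_quotient_pp[OF p, of r "r - 2" 1 "r - w + 1" "r - w"]
      by (simp add: quotient_period_exponent_def Carmichael_twopow_ge_8)
  qed
qed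

section \<open>From prime power moduli to the whole sequence\<close>

theorem proposition3p8:
  fixes m k :: nat and p r w M :: "nat \<Rightarrow> nat" and m' :: "nat \<Rightarrow> int" and a :: "nat \<Rightarrow> int"
  assumes "m \<ge> 2"
    and "\<And>i. i \<in> {1..k} \<Longrightarrow> prime (p i)"
    and "inj_on p {1..k}"
    and "\<And>i. i \<in> {1..k} \<Longrightarrow> r i \<ge> 1"
    and "m = (\<Prod>i=1..k. p i ^ r i)"
    and "\<And>i. i \<in> {1..k} \<Longrightarrow> M i = m div p i ^ r i"
    and "\<And>i. i \<in> {1..k} \<Longrightarrow> [int (M i) ^ 2 * m' i = 1] (mod int (p i ^ r i))"
    and "\<And>n. n \<ge> 1 \<Longrightarrow>
           [a n = (\<Sum>i=1..k. int (M i) * m' i * int (Carmichael m div Carmichael (p i ^ r i))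
                               * carmichael_quotient_pp (p i) (r i) (int n))] (mod int m)"
    and "\<And>n. n \<ge> 1 \<Longrightarrow> 0 \<le> a n \<and> a n \<le> int m - 1"
    and "\<And>i. i \<in> {1..k} \<Longrightarrow>
           p i ^ w i = gcd (Carmichael m div Carmichael (p i ^ r i)) (p i ^ r i)"
  shows "\<exists>T Ts. is_least_period a T \<and>
           (\<forall>i\<in>{1..k}.
              is_least_period (\<lambda>n. a n mod int (p i ^ r i)) (Ts i) \<and>
              (odd (p i) \<longrightarrow>
                 (w i = r i \<longrightarrow> Ts i = 1) \<and>
                 (w i < r i \<longrightarrow> Ts i = p i ^ (r i - w i + 1))) \<and>
              (p i = 2 \<longrightarrow>
                 (w i = r i \<longrightarrow> Ts i = 1) \<and>
                 (r i = 1 \<and> w i = 0 \<longrightarrow> Ts i = 4) \<and>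
                 (r i = 2 \<and> w i = 0 \<longrightarrow> Ts i = 8) \<and>
                 (r i = 2 \<and> w i = 1 \<longrightarrow> Ts i = 1) \<and>
                 (r i \<ge> 3 \<and> w i < r i \<longrightarrow> Ts i = 2 ^ (r i - w i + 2)))) \<and>
           T = (\<Prod>i=1..k. Ts i)"
proof -
  note p = assms(2) and r = assms(4) and m = assms(5) and M = assms(6) and m' = assms(7)
    and a = assms(8) and bounds = assms(9) and w = assms(10)
  define P where "P i = p i ^ r i" for i
  define q where "q i = Carmichael m div Carmichael (P i)" for i
  define C where "C i n = carmichael_quotient_pp (p i) (r i) (int n)" for i n
  define Ts where "Ts i = p i ^ quotient_period_exponent (p i) (r i) (w i)" for i
  have Ppos: "P i > 0" if "i \<in> {1..k}" for i
    using p[OF that] by (simp add: P_def prime_gt_0_nat)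
  have mP: "m = (\<Prod>i=1..k. P i)" using m by (simp add: P_def)
  have Pdvd: "P i dvd m" if "i \<in> {1..k}" for i
    unfolding mP using that by (intro dvd_prodI) auto
  have copp: "coprime (p i) (p j)" if "i \<in> {1..k}" "j \<in> {1..k}" "i \<noteq> j" for i j
    using that p assms(3) by (intro primes_coprime) (auto dest: inj_onD)

  have wle: "w i \<le> r i" if i: "i \<in> {1..k}" for i
  proof -
    have "p i ^ w i dvd p i ^ r i" using w[OF i] by simp
    thus ?thesis using prime_gt_1_nat[OF p[OF i]] by (rule power_dvd_imp_le)
  qed

  have Mdvd: "P i dvd M j" if i: "i \<in> {1..k}" and j: "j \<in> {1..k}" and "i \<noteq> j" for i j
  proof -
    have "m = P j * prod P ({1..k} - {j})"
      unfolding mP using j by (intro prod.remove) auto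
    hence "M j = prod P ({1..k} - {j})"
      using M[OF j] Ppos[OF j] by (metis P_def nonzero_mult_div_cancel_left not_gr0)
    thus ?thesis using i \<open>i \<noteq> j\<close> by (auto intro: dvd_prodI)
  qed

  have red: "[a n = int (M i) * m' i * (int (q i) * C i n)] (mod int (P i))"
    if i: "i \<in> {1..k}" and n: "n \<ge> 1" for i n
  proof -
    define f where "f j = int (M j) * m' j * int (q j) * C j n" for j
    have "[a n = (\<Sum>j=1..k. f j)] (mod int m)"
      using a[OF n] by (simp add: f_def q_def P_def C_def)
    hence "[a n = (\<Sum>j=1..k. f j)] (mod int (P i))"
      by (rule cong_dvd_modulus) (use Pdvd[OF i] in simp)
    also have "(\<Sum>j=1..k. f j) = f i + (\<Sum>j\<in>{1..k}-{i}. f j)"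
      using i by (intro sum.remove) auto
    also have "int (P i) dvd (\<Sum>j\<in>{1..k}-{i}. f j)"
      using Mdvd[OF i] by (intro dvd_sum) (auto simp: f_def intro!: dvd_mult2)
    hence "[f i + (\<Sum>j\<in>{1..k}-{i}. f j) = f i] (mod int (P i))"
      by (simp add: cong_iff_dvd_diff)
    finally show ?thesis by (simp add: f_def mult.assoc)
  qed

  have key: "a x mod int (P i) = a y mod int (P i) \<longleftrightarrow>
             C i x mod int (p i) ^ (r i - w i) = C i y mod int (p i) ^ (r i - w i)"
    if i: "i \<in> {1..k}" and x: "x \<ge> 1" and y: "y \<ge> 1" for i x y
  proof -
    let ?u = "int (M i) * m' i"
    \<comment> \<open>The defining congruence of \<open>m' i\<close> exhibits \<open>M i\<close> as
      an inverse of \<open>?u\<close>, so \<open>?u\<close> cancels.\<close>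
    have "[int (M i) * ?u = 1] (mod int (P i))"
      using m'[OF i] by (simp add: P_def power2_eq_square mult.assoc)
    hence "coprime ?u (int (P i))"
      by (metis coprime_iff_invertible_int mult.commute)
    hence "[?u * (int (q i) * C i x) = ?u * (int (q i) * C i y)] (mod int (P i)) \<longleftrightarrow>
           [int (q i) * C i x = int (q i) * C i y] (mod int (P i))"
      by (rule cong_mult_lcancel)
    also have "\<dots> \<longleftrightarrow> [C i x = C i y] (mod int (P i) div gcd (int (q i)) (int (P i)))"
      by (rule cong_mult_cancel_gcd) (use Ppos[OF i] in simp)
    also have "gcd (int (q i)) (int (P i)) = int (p i ^ w i)"
      using w[OF i] by (simp add: q_def P_def gcd_int_int_eq del: of_nat_power)
    also have "int (P i) div int (p i ^ w i) = int (p i) ^ (r i - w i)"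
      using wle[OF i] prime_gt_0_nat[OF p[OF i]] by (simp add: P_def power_diff)
    finally show ?thesis
      using red[OF i x] red[OF i y] by (simp add: cong_def)
  qed

  have Ts: "is_least_period (\<lambda>n. a n mod int (P i)) (Ts i)" if i: "i \<in> {1..k}" for i
    using is_least_period_carmichael_quotient_pp_mod[OF p[OF i] r[OF i] wle[OF i]]
      is_least_period_cong[OF key[OF i]] by (simp add: Ts_def C_def)

  \<comment> \<open>Coprime moduli combine to a congruence modulo \<open>m\<close>, and the bounds
    on \<open>a\<close> turn it into an equality.\<close>
  have aeq: "a x = a y \<longleftrightarrow> (\<forall>i\<in>{1..k}. a x mod int (P i) = a y mod int (P i))"
    if "x \<ge> 1" "y \<ge> 1" for x y
  proof
    assume "\<forall>i\<in>{1..k}. a x mod int (P i) = a y mod int (P i)"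
    hence "[a x = a y] (mod (\<Prod>i\<in>{1..k}. int (P i)))"
      by (intro cong_cong_prod_coprime) (auto simp: cong_def P_def copp)
    hence "[a x = a y] (mod int m)" by (simp add: mP)
    thus "a x = a y"
      using bounds[OF that(1)] bounds[OF that(2)] by (intro cong_less_imp_eq_int) auto
  qed simp

  \<comment> \<open>An empty product would give \<open>m = 1\<close>.\<close>
  have "k \<noteq> 0" using m assms(1) by (intro notI) simp
  hence "is_least_period a (\<Prod>i=1..k. Ts i)"
    using Ts aeq by (intro is_least_period_prod) (auto simp: Ts_def copp)
  moreover have "(odd (p i) \<longrightarrow>
                 (w i = r i \<longrightarrow> Ts i = 1) \<and>
                 (w i < r i \<longrightarrow> Ts i = p i ^ (r i - w i + 1))) \<and>
              (p i = 2 \<longrightarrow>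
                 (w i = r i \<longrightarrow> Ts i = 1) \<and>
                 (r i = 1 \<and> w i = 0 \<longrightarrow> Ts i = 4) \<and>
                 (r i = 2 \<and> w i = 0 \<longrightarrow> Ts i = 8) \<and>
                 (r i = 2 \<and> w i = 1 \<longrightarrow> Ts i = 1) \<and>
                 (r i \<ge> 3 \<and> w i < r i \<longrightarrow> Ts i = 2 ^ (r i - w i + 2)))" for i
    by (auto simp: Ts_def quotient_period_exponent_def)
  ultimately show ?thesis
    using Ts unfolding P_def by blast
qed

end
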